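(* For all real symmetric $d\times d$ matrices $A$ and $B$, $$\mathbb{E}_{P\in A_d}\det(A+PBP^T)=\mathbb{E}_{Q\in O(d)}\det(A+QBQ^T),$$ where $P$ is uniformly distributed on the finite group $A_d$ and $Q$ is distributed according to Haar measure on the orthogonal group $O(d)$.
   Context: $A_d$ denotes the group of orthogonal transformations of $\mathbb{R}^d$ that map a fixed regular simplex in $\mathbb{R}^d$ (with $d+1$ vertices, centered at the origin) to itself, i.e. that permute its vertices; it is a finite subgroup of $O(d)$. *)

theory Defs
  imports "HOL-Probability.Probability"
begin

text \<open>
  Vertex set of a regular simplex in \<open>\<real>\<^sup>d\<close>, \<open>d = CARD('d)\<close>, centred at the origin.
\<close>

definition centered_regular_simplex :: "(real ^ 'd) set \<Rightarrow> bool" where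
  "centered_regular_simplex V \<longleftrightarrow>
     card V = CARD('d) + 1 \<and> \<not> affine_dependent V \<and>
     (\<exists>r. \<forall>x\<in>V. \<forall>y\<in>V. x \<noteq> y \<longrightarrow> dist x y = r) \<and>
     (\<Sum>x\<in>V. x) = 0"

definition simplex_group :: "(real ^ 'd) set \<Rightarrow> (real ^ 'd ^ 'd) set" where
  "simplex_group V =
     {P. orthogonal_matrix P \<and> (\<lambda>x. P *v x) ` (convex hull V) = convex hull V}"

definition orthogonal_group :: "(real ^ 'd ^ 'd) set" where
  "orthogonal_group = {Q. orthogonal_matrix Q}"

text \<open>
  Normalised Haar measure: the left-invariant Borel probability measure on \<open>O(d)\<close>.  As \<open>O(d)\<close> is
  a compact metrisable group, regularity of the measure is automatic, such a measure is unique,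
  and it is right-invariant as well.
\<close>

definition haar_orthogonal :: "(real ^ 'd ^ 'd) measure \<Rightarrow> bool" where
  "haar_orthogonal \<mu> \<longleftrightarrow>
     prob_space \<mu> \<and>
     sets \<mu> = sets (restrict_space borel orthogonal_group) \<and>
     (\<forall>R\<in>orthogonal_group. distr \<mu> \<mu> (\<lambda>Q. R ** Q) = \<mu>)"

lemma simplex_group_iff_permutes_vertices:
  fixes V :: "(real ^ 'd) set"
  assumes "centered_regular_simplex V"
  shows "P \<in> simplex_group V \<longleftrightarrow> orthogonal_matrix P \<and> (\<lambda>x. P *v x) ` V = V"
proof -
  let ?f = "\<lambda>x. P *v x"
  have ai: "\<not> affine_dependent V"
    using assms by (simp add: centered_regular_simplex_def)
  have hull: "?f ` (convex hull V) = convex hull (?f ` V)"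
    by (simp add: convex_hull_linear_image)
  have "?f ` V = V" if P: "orthogonal_matrix P" and eq: "convex hull (?f ` V) = convex hull V"
  proof -
    have "inj ?f"
      using P by (metis (no_types, lifting) injI matrix_vector_mul_assoc matrix_vector_mul_lid
          orthogonal_matrix_def)
    have ext: "x extreme_point_of (convex hull V) \<longleftrightarrow> x \<in> V" for x
      using ai by (rule extreme_point_of_convex_hull_affine_independent)
    have "?f x extreme_point_of (?f ` (convex hull V))" if "x \<in> V" for x
      using that ext \<open>inj ?f\<close> face_of_linear_image[of ?f "{x}" "convex hull V"]
      by (simp add: face_of_singleton)
    then have "?f ` V \<subseteq> V"
      using ext hull eq by auto
    moreover have "finite V"
      using ai by (rule aff_independent_finite)
    ultimately show ?thesis
      using \<open>inj ?f\<close> by (meson endo_inj_surj inj_on_subset subset_UNIV)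
  qed
  then show ?thesis
    by (auto simp: simplex_group_def hull)
qed

lemma finite_simplex_group:
  fixes V :: "(real ^ 'd) set"
  assumes V: "centered_regular_simplex V"
  shows "finite (simplex_group V)"
proof -
  have ai: "\<not> affine_dependent V" and card: "card V = CARD('d) + 1"
    using V by (simp_all add: centered_regular_simplex_def)
  have "affine hull V = UNIV"
    using ai card by (intro affine_independent_span_eq) auto
  then have span: "span V = UNIV"
    using affine_hull_subset_span[of V] by auto
  have fin: "finite V"
    using ai by (rule aff_independent_finite)
  let ?r = "\<lambda>P. restrict (\<lambda>x. P *v x) V"
  have "inj_on ?r (simplex_group V)"
  proof (rule inj_onI)
    fix P Q assume eq: "?r P = ?r Q"
    have "P *v x = Q *v x" if "x \<in> V" for x
      using fun_cong[OF eq, of x] that by simp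
    then have "P *v x = Q *v x" for x
      using linear_eq_on[of "\<lambda>x. P *v x" "\<lambda>x. Q *v x" x V] span by auto
    then show "P = Q"
      by (simp add: matrix_eq)
  qed
  moreover have "?r ` simplex_group V \<subseteq> V \<rightarrow>\<^sub>E V"
    using simplex_group_iff_permutes_vertices[OF V] by fastforce
  ultimately show ?thesis
    using fin by (meson finite_PiE finite_imageD finite_subset)
qed

end

theory Submission
  imports Defs
begin

text \<open>
  Write \<open>F B\<close> for the sum of \<open>det (A + P B P\<^sup>T)\<close> over the simplex group.  It suffices to show that
  \<open>F (Q B Q\<^sup>T) = F B\<close> for every orthogonal \<open>Q\<close>: averaging over \<open>Q\<close> and using the invariance of Haar measure
  then gives the claim.

  For a unit vector \<open>u\<close> with reflection \<open>H\<close>, \<open>det (A + H B H) = - det (A H + H B)\<close>, and \<open>A H + H B\<close> is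
  \<open>A + B\<close> plus two matrices of rank one, so on a plane this is an even polynomial of degree at most 4 in \<open>u\<close>.
  The sum of such a polynomial over three unit vectors at angles of 60 degrees does not change when the
  three vectors are rotated together.  The edges of a triangular face of the simplex are such a triple, and their
  reflections are transpositions of vertices, so \<open>F\<close> is invariant under all reflections in vectors
  of the plane of the face.

  The group of symmetries of \<open>F\<close> is compact.  If \<open>z\<close> has maximal inner product with an edge \<open>e\<close> among the
  images of a vector \<open>u\<close> under this group, then \<open>z\<close> is parallel to \<open>e\<close>; hence the reflection in \<open>u\<close> is conjugate
  to the one in \<open>e\<close> and lies in the group.  Reflections generate the orthogonal group.
\<close>

subsection \<open>Rank one updates and reflections\<close>

definition outer_prod :: "real ^ 'n \<Rightarrow> real ^ 'n \<Rightarrow> real ^ 'n ^ 'n" where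
  "outer_prod a b = (\<chi> i j. a $ i * b $ j)"

text \<open>
  \<open>reflection 0\<close> is the identity matrix, because \<open>2 / 0 = 0\<close>.
\<close>
definition reflection :: "real ^ 'n \<Rightarrow> real ^ 'n ^ 'n" where
  "reflection u = mat 1 - (2 / (u \<bullet> u)) *\<^sub>R outer_prod u u"

lemma outer_prod_nth [simp]: "outer_prod a b $ i $ j = a $ i * b $ j"
  by (simp add: outer_prod_def)

lemma outer_prod_0_left [simp]: "outer_prod 0 b = 0"
  by (simp add: vec_eq_iff)

lemma transpose_outer_prod: "transpose (outer_prod a b) = outer_prod b a"
  by (simp add: vec_eq_iff transpose_def)

lemma transpose_add: "transpose (A + B) = transpose A + transpose B"
  for A :: "'a::plus ^ 'n ^ 'm"
  by (simp add: vec_eq_iff transpose_def)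

lemma outer_prod_mult_vec: "outer_prod a b *v x = (b \<bullet> x) *\<^sub>R a"
  by (simp add: vec_eq_iff matrix_vector_mult_def inner_vec_def sum_distrib_left sum_distrib_right mult_ac)

lemma matrix_mult_outer_prod: "M ** outer_prod a b = outer_prod (M *v a) b"
  by (simp add: vec_eq_iff matrix_matrix_mult_def matrix_vector_mult_def sum_distrib_left sum_distrib_right mult_ac)

lemma outer_prod_matrix_mult: "outer_prod a b ** M = outer_prod a (transpose M *v b)"
  by (simp add: vec_eq_iff matrix_matrix_mult_def matrix_vector_mult_def transpose_def sum_distrib_left mult_ac)

lemma reflection_mult_vec: "reflection u *v x = x - (2 * (u \<bullet> x) / (u \<bullet> u)) *\<^sub>R u"
  by (simp add: reflection_def matrix_vector_mult_diff_rdistrib outer_prod_mult_vec flip: scaleR_matrix_vector_assoc)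

lemma transpose_reflection [simp]: "transpose (reflection u) = reflection u"
  by (simp add: vec_eq_iff transpose_def reflection_def mat_def)

lemma reflection_mult_self [simp]: "reflection u ** reflection u = mat 1"
proof -
  have "reflection u *v (reflection u *v x) = x" for x
    by (cases "u = 0") (auto simp: reflection_mult_vec inner_diff_right algebra_simps simp flip: scaleR_add_left)
  then show ?thesis
    by (simp add: matrix_eq matrix_vector_mul_assoc)
qed

lemma orthogonal_matrix_reflection [simp]: "orthogonal_matrix (reflection u)"
  by (simp add: orthogonal_matrix)

lemma orthogonal_matrix_vec_inner:
  fixes Q :: "real ^ 'n ^ 'n"
  assumes "orthogonal_matrix Q"
  shows "(Q *v x) \<bullet> (Q *v y) = x \<bullet> y"
proof -
  have "orthogonal_transformation ((*v) Q)"
    using assms by (simp add: orthogonal_transformation_matrix)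
  then show ?thesis
    by (simp add: orthogonal_transformation_def)
qed

text \<open>Orthogonality of \<open>Q\<close> preserves the coefficient in
  \<open>reflection_mult_vec\<close>, so the two sides agree on every vector
  \<open>Q *v x\<close>.\<close>

lemma reflection_conjugate:
  assumes Q: "orthogonal_matrix Q"
  shows "reflection (Q *v u) = Q ** reflection u ** transpose Q"
proof -
  have "reflection (Q *v u) *v (Q *v x) = Q *v (reflection u *v x)" for x
    by (simp add: reflection_mult_vec orthogonal_matrix_vec_inner[OF Q] matrix_vector_mult_diff_distrib
        matrix_vector_mult_scaleR)
  then have "reflection (Q *v u) ** Q = Q ** reflection u"
    by (simp add: matrix_eq flip: matrix_vector_mul_assoc)
  then have "reflection (Q *v u) ** (Q ** transpose Q) = Q ** reflection u ** transpose Q"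
    by (simp add: matrix_mul_assoc)
  then show ?thesis
    using Q by (simp add: orthogonal_matrix_def)
qed

lemma reflection_scaleR: "c \<noteq> 0 \<Longrightarrow> reflection (c *\<^sub>R u) = reflection u"
  by (simp add: vec_eq_iff reflection_def divide_simps)

text \<open>An orthogonal \<open>M\<close> taking a coordinate axis to the direction of
  \<open>u\<close> conjugates the reflection to a diagonal matrix with a single entry -1.\<close>

lemma det_reflection:
  fixes u :: "real ^ 'n"
  assumes "u \<noteq> 0"
  shows "det (reflection u) = -1"
proof -
  define a where "a = (1 / norm u) *\<^sub>R u"
  have "norm a = 1"
    using assms by (simp add: a_def)
  then obtain M k where M: "orthogonal_matrix M" and a: "M *v axis k 1 = a"
    using orthogonal_matrix_exists_basis by metis
  have "reflection u = M ** reflection (axis k 1) ** transpose M"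
    using assms reflection_conjugate[OF M, of "axis k 1"] by (simp add: a a_def reflection_scaleR)
  moreover have "det M * det M = 1"
    using det_orthogonal_matrix[OF M] by auto
  moreover have "det (reflection (axis k 1)) = (\<Prod>i\<in>UNIV. if i = k then -1 else 1 :: real)"
  proof -
    have unit: "axis k (1::real) \<bullet> axis k 1 = 1"
      by (simp add: inner_axis_axis)
    have diag: "reflection (axis k 1) $ i $ i = (if i = k then -1 else 1 :: real)" for i
      by (simp add: reflection_def unit mat_def) (simp add: axis_def)
    have "reflection (axis k (1::real)) $ i $ j = 0" if "i \<noteq> j" for i j
      using that by (auto simp: reflection_def mat_def axis_def)
    then show ?thesis
      by (simp add: det_diagonal diag)
  qed
  ultimately show ?thesis
    by (simp add: det_mul)
qed

lemma det_add_outer_prod_linear: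
  fixes C :: "real ^ 'n ^ 'n"
  shows "linear (\<lambda>b. det (C + outer_prod a b) - det C)"
proof (cases "a = 0")
  case True
  then show ?thesis by (simp add: linear_iff)
next
  case False
  \<comment> \<open>In an orthonormal basis containing \<open>a / norm a\<close>, only one row depends on \<open>b\<close>.\<close>
  define a' where "a' = (1 / norm a) *\<^sub>R a"
  have "norm a' = 1"
    using False by (simp add: a'_def)
  then obtain M k where M: "orthogonal_matrix M" and a': "M *v axis k 1 = a'"
    using orthogonal_matrix_exists_basis by metis
  have MM: "transpose M ** M = mat 1"
    using M by (simp add: orthogonal_matrix)
  define N where "N = transpose M ** C"
  have "transpose M *v a' = axis k 1"
    by (simp add: MM matrix_vector_mul_assoc flip: a')
  moreover have "a = norm a *\<^sub>R a'"
    using False by (simp add: a'_def)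
  ultimately have tMa: "transpose M *v a = norm a *\<^sub>R axis k 1"
    by (metis matrix_vector_mult_scaleR)
  have row: "det (C + outer_prod a b) =
      det M * (det N + norm a * det (\<chi> i. if i = k then b else N $ i))" for b
  proof -
    have "det (transpose M ** (C + outer_prod a b)) = det (\<chi> i. if i = k then N $ k + norm a *s b else N $ i)"
      by (rule arg_cong[where f = det])
         (auto simp: N_def matrix_add_ldistrib matrix_mult_outer_prod tMa vec_eq_iff axis_def
            simp del: transpose_matrix_vector)
    also have "\<dots> = det (\<chi> i. if i = k then N $ k else N $ i) + det (\<chi> i. if i = k then norm a *s b else N $ i)"
      by (rule det_row_add)
    also have "(\<chi> i. if i = k then N $ k else N $ i) = N"
      by (simp add: vec_eq_iff)
    also have "det (\<chi> i. if i = k then norm a *s b else N $ i) = norm a * det (\<chi> i. if i = k then b else N $ i)"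
      by (rule det_row_mul)
    finally have "det M * det M * det (C + outer_prod a b) =
        det M * (det N + norm a * det (\<chi> i. if i = k then b else N $ i))"
      by (simp add: det_mul)
    moreover have "det M * det M = 1"
      using det_orthogonal_matrix[OF M] by auto
    ultimately show ?thesis by simp
  qed
  have "det C = det M * det N"
    using det_orthogonal_matrix[OF M] by (auto simp: N_def det_mul)
  then have eq: "det (C + outer_prod a b) - det C =
      det M * norm a * det (\<chi> i. if i = k then b else N $ i)" for b
    by (simp add: row algebra_simps)
  show ?thesis
    unfolding eq linear_iff
    using det_row_add[of k "\<lambda>_. x" "\<lambda>_. y" "\<lambda>i. N $ i" for x y]
      det_row_mul[of k c "\<lambda>_. x" "\<lambda>i. N $ i" for c x, unfolded scalar_mult_eq_scaleR]
    by (simp add: algebra_simps)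
qed

text \<open>Transposition exchanges the two factors of the outer product and keeps the determinant,
  so linearity in \<open>a\<close> reduces to linearity in \<open>b\<close>.\<close>

lemma bilinear_det_add_outer_prod: "bilinear (\<lambda>a b. det (C + outer_prod a b) - det C)"
proof -
  have "det (C + outer_prod a b) - det C = det (transpose C + outer_prod b a) - det (transpose C)" for a b
    by (metis det_transpose transpose_add transpose_outer_prod)
  then have "linear (\<lambda>a. det (C + outer_prod a b) - det C)" for b
    using det_add_outer_prod_linear[of "transpose C" b] by presburger
  then show ?thesis
    by (simp add: bilinear_def det_add_outer_prod_linear)
qed

subsection \<open>Quadrature on a plane\<close>

text \<open>The maps \<open>f\<close> and \<open>g\<close> allow a vector of the plane or its image
  under a matrix to be inserted in either argument.\<close>

lemma bilinear_on_plane: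
  assumes "bilinear N" "linear f" "linear g"
  shows "N (f (x *\<^sub>R p + y *\<^sub>R q)) (g (x *\<^sub>R p + y *\<^sub>R q)) =
    x\<^sup>2 * N (f p) (g p) + x * y * (N (f p) (g q) + N (f q) (g p)) + y\<^sup>2 * (N (f q) (g q) :: real)"
  using assms
  by (simp add: linear_add linear_scale bilinear_ladd bilinear_radd bilinear_lmul bilinear_rmul
      algebra_simps power2_eq_square)

lemma bilinear_diff:
  "bilinear f \<Longrightarrow> bilinear g \<Longrightarrow> bilinear (\<lambda>x y. f x y - g x y)"
  by (simp add: bilinear_def linear_compose_sub)

text \<open>Each outer product contains the vector of the plane twice, once through a linear map.
  Single updates therefore contribute quadratic forms and their interaction a quartic form; no odd
  terms arise.\<close>

lemma det_rank_two_update_on_plane: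
  fixes C A B :: "real ^ 'n ^ 'n"
  obtains c0 c1 c2 c3 c4 c5 c6 c7 c8 where
    "\<And>x y. det (C + outer_prod (A *v (x *\<^sub>R p + y *\<^sub>R q)) (x *\<^sub>R p + y *\<^sub>R q)
              + outer_prod (x *\<^sub>R p + y *\<^sub>R q) (B *v (x *\<^sub>R p + y *\<^sub>R q))) =
       c0 + (c1 * x\<^sup>2 + c2 * (x * y) + c3 * y\<^sup>2)
         + (c4 * x ^ 4 + c5 * (x ^ 3 * y) + c6 * (x\<^sup>2 * y\<^sup>2) + c7 * (x * y ^ 3) + c8 * y ^ 4)"
proof -
  define L where "L a u = det (C + outer_prod a u) - det C" for a u
  \<comment> \<open>\<open>M\<close> is the mixed second difference of the determinant, the joint
    effect of the two updates. It is symmetric in the updates, hence bilinear in each pair of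
    arguments.\<close>
  define M where "M w b a u = det (C + outer_prod w b + outer_prod a u) - det (C + outer_prod w b) - L a u" for w b a u
  have L: "bilinear L"
    unfolding L_def by (rule bilinear_det_add_outer_prod)
  have M1: "bilinear (M w b)" for w b
    unfolding M_def by (rule bilinear_diff[OF bilinear_det_add_outer_prod L])
  have M2: "bilinear (\<lambda>w b. M w b a u)" for a u
  proof -
    have "(\<lambda>w b. M w b a u) =
        (\<lambda>w b. det (C + outer_prod a u + outer_prod w b) - det (C + outer_prod a u) - L w b)"
      by (simp add: M_def L_def algebra_simps fun_eq_iff)
    then show ?thesis
      using bilinear_diff[OF bilinear_det_add_outer_prod L] by simp
  qed
  let ?v = "\<lambda>x y. x *\<^sub>R p + y *\<^sub>R q"
  have expand: "N (f (?v x y)) (g (?v x y)) =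
      x\<^sup>2 * N (f p) (g p) + x * y * (N (f p) (g q) + N (f q) (g p)) + y\<^sup>2 * N (f q) (g q)"
    if "bilinear N" "linear f" "linear g" for N :: "real ^ 'n \<Rightarrow> real ^ 'n \<Rightarrow> real" and f g x y
    using that by (rule bilinear_on_plane)
  note lin = matrix_vector_mul_linear[of A] matrix_vector_mul_linear[of B] linear_ident
  define m where "m i j k l = M (A *v i) j k (B *v l)" for i j k l
  have "det (C + outer_prod (A *v (?v x y)) (?v x y) + outer_prod (?v x y) (B *v (?v x y))) =
    det C +
    ((L (A *v p) p + L p (B *v p)) * x\<^sup>2
     + (L (A *v p) q + L (A *v q) p + L p (B *v q) + L q (B *v p)) * (x * y)
     + (L (A *v q) q + L q (B *v q)) * y\<^sup>2) +
    (m p p p p * x ^ 4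
     + (m p p p q + m p p q p + m p q p p + m q p p p) * (x ^ 3 * y)
     + (m p p q q + m q q p p + m p q p q + m p q q p + m q p p q + m q p q p) * (x\<^sup>2 * y\<^sup>2)
     + (m q q q p + m q q p q + m q p q q + m p q q q) * (x * y ^ 3)
     + m q q q q * y ^ 4)" (is "?lhs x y = _") for x y
  proof -
    have "?lhs x y = det C + L (A *v ?v x y) (?v x y) + L (?v x y) (B *v ?v x y)
        + M (A *v ?v x y) (?v x y) (?v x y) (B *v ?v x y)"
      by (simp add: M_def L_def)
    also have "\<dots> = det C
        + (x\<^sup>2 * L (A *v p) p + x * y * (L (A *v p) q + L (A *v q) p) + y\<^sup>2 * L (A *v q) q)
        + (x\<^sup>2 * L p (B *v p) + x * y * (L p (B *v q) + L q (B *v p)) + y\<^sup>2 * L q (B *v q))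
        + (x\<^sup>2 * M (A *v ?v x y) (?v x y) p (B *v p)
          + x * y * (M (A *v ?v x y) (?v x y) p (B *v q) + M (A *v ?v x y) (?v x y) q (B *v p))
          + y\<^sup>2 * M (A *v ?v x y) (?v x y) q (B *v q))"
      by (simp only: expand[OF L lin(1,3)] expand[OF L lin(3,2)] expand[OF M1 lin(3,2)])
    also have "\<dots> = det C
        + (x\<^sup>2 * L (A *v p) p + x * y * (L (A *v p) q + L (A *v q) p) + y\<^sup>2 * L (A *v q) q)
        + (x\<^sup>2 * L p (B *v p) + x * y * (L p (B *v q) + L q (B *v p)) + y\<^sup>2 * L q (B *v q))
        + (x\<^sup>2 * (x\<^sup>2 * m p p p p + x * y * (m p q p p + m q p p p) + y\<^sup>2 * m q q p p)
          + x * y * ((x\<^sup>2 * m p p p q + x * y * (m p q p q + m q p p q) + y\<^sup>2 * m q q p q)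
            + (x\<^sup>2 * m p p q p + x * y * (m p q q p + m q p q p) + y\<^sup>2 * m q q q p))
          + y\<^sup>2 * (x\<^sup>2 * m p p q q + x * y * (m p q q q + m q p q q) + y\<^sup>2 * m q q q q))"
      by (simp only: expand[OF M2 lin(1,3)] m_def)
    finally show ?thesis
      by algebra
  qed
  then show ?thesis
    by (rule that)
qed

text \<open>
  The three arguments are \<open>(x, y)\<close> and its rotations by 60 and 120 degrees, with \<open>s\<close> the square root of 3
  up to sign.
\<close>
lemma quartic_hexagon_sum:
  fixes f :: "real \<Rightarrow> real \<Rightarrow> real"
  assumes f: "\<And>x y. f x y = c0 + (c1 * x\<^sup>2 + c2 * (x * y) + c3 * y\<^sup>2)
         + (c4 * x ^ 4 + c5 * (x ^ 3 * y) + c6 * (x\<^sup>2 * y\<^sup>2) + c7 * (x * y ^ 3) + c8 * y ^ 4)"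
    and s: "s\<^sup>2 = 3" and xy: "x\<^sup>2 + y\<^sup>2 = 1"
  shows "f x y + f ((x - s * y) / 2) ((s * x + y) / 2) + f ((- x - s * y) / 2) ((s * x - y) / 2) =
    3 * c0 + 3 / 2 * (c1 + c3) + 3 / 8 * (3 * c4 + c6 + 3 * c8)"
proof -
  have ss: "s * s = 3" "s * (s * z) = 3 * z" for z
    using s by (simp_all add: power2_eq_square flip: mult.assoc)
  note expand = power2_eq_square power3_eq_cube power4_eq_xxxx algebra_simps
    add_divide_distrib diff_divide_distrib ss
  let ?X = "(x - s * y) / 2" and ?Y = "(s * x + y) / 2"
  let ?Z = "(- x - s * y) / 2" and ?W = "(s * x - y) / 2"
  \<comment> \<open>Together with their antipodes the three points form a regular hexagon, a
    5-design: their moments of degree 2 and 4 are three times the means over the circle through (x,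
    y).\<close>
  have m: "x\<^sup>2 + ?X\<^sup>2 + ?Z\<^sup>2 = 3 / 2 * (x\<^sup>2 + y\<^sup>2)"
    "x * y + ?X * ?Y + ?Z * ?W = 0"
    "y\<^sup>2 + ?Y\<^sup>2 + ?W\<^sup>2 = 3 / 2 * (x\<^sup>2 + y\<^sup>2)"
    "x ^ 4 + ?X ^ 4 + ?Z ^ 4 = 9 / 8 * (x\<^sup>2 + y\<^sup>2)\<^sup>2"
    "x ^ 3 * y + ?X ^ 3 * ?Y + ?Z ^ 3 * ?W = 0"
    "x\<^sup>2 * y\<^sup>2 + ?X\<^sup>2 * ?Y\<^sup>2 + ?Z\<^sup>2 * ?W\<^sup>2 = 3 / 8 * (x\<^sup>2 + y\<^sup>2)\<^sup>2"
    "x * y ^ 3 + ?X * ?Y ^ 3 + ?Z * ?W ^ 3 = 0"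
    "y ^ 4 + ?Y ^ 4 + ?W ^ 4 = 9 / 8 * (x\<^sup>2 + y\<^sup>2)\<^sup>2"
    by (simp_all add: expand)
  have "f x y + f ?X ?Y + f ?Z ?W = 3 * c0
      + c1 * (x\<^sup>2 + ?X\<^sup>2 + ?Z\<^sup>2)
      + c2 * (x * y + ?X * ?Y + ?Z * ?W)
      + c3 * (y\<^sup>2 + ?Y\<^sup>2 + ?W\<^sup>2)
      + c4 * (x ^ 4 + ?X ^ 4 + ?Z ^ 4)
      + c5 * (x ^ 3 * y + ?X ^ 3 * ?Y + ?Z ^ 3 * ?W)
      + c6 * (x\<^sup>2 * y\<^sup>2 + ?X\<^sup>2 * ?Y\<^sup>2 + ?Z\<^sup>2 * ?W\<^sup>2)
      + c7 * (x * y ^ 3 + ?X * ?Y ^ 3 + ?Z * ?W ^ 3)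
      + c8 * (y ^ 4 + ?Y ^ 4 + ?W ^ 4)"
    unfolding f by algebra
  then show ?thesis
    unfolding m xy by (simp add: field_simps)
qed

section \<open>Conjugation by a reflection as a rank-two update\<close>

lemma outer_prod_scaleR_left: "outer_prod (c *\<^sub>R a) b = c *\<^sub>R outer_prod a b"
  by (simp add: vec_eq_iff)

lemma outer_prod_scaleR_right: "outer_prod a (c *\<^sub>R b) = c *\<^sub>R outer_prod a b"
  by (simp add: vec_eq_iff)

lemma matrix_diff_ldistrib: "A ** (B - C) = A ** B - A ** C"
  for A :: "real ^ 'n ^ 'm"
  by (simp add: vec_eq_iff matrix_matrix_mult_def algebra_simps sum_subtractf)

lemma matrix_diff_rdistrib: "(B - C) ** A = B ** A - C ** A"
  for A :: "real ^ 'n ^ 'm"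
  by (simp add: vec_eq_iff matrix_matrix_mult_def algebra_simps sum_subtractf)

lemma matrix_add_rdistrib: "(B + C) ** A = B ** A + C ** A"
  for A :: "real ^ 'n ^ 'm"
  by (simp add: vec_eq_iff matrix_matrix_mult_def algebra_simps sum.distrib)

text \<open>Factoring one reflection out on the right leaves each summand with a single reflection,
  hence a single rank-one update. The factor -2 is attached to the matrix to give the updates the
  shape of \<open>det_rank_two_update_on_plane\<close>.\<close>

lemma det_add_reflection_conjugate:
  fixes A B :: "real ^ 'n ^ 'n"
  assumes u: "u \<bullet> u = 1"
  shows "det (A + reflection u ** B ** reflection u) =
    - det (A + B + outer_prod (((-2) *\<^sub>R A) *v u) u + outer_prod u (((-2) *\<^sub>R transpose B) *v u))"
proof -
  have "u \<noteq> 0"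
    using u by auto
  have scale: "((-2) *\<^sub>R M) *v u = (-2) *\<^sub>R (M *v u)" for M :: "real ^ 'n ^ 'n"
    by (rule scaleR_matrix_vector_assoc[symmetric])
  have AH: "A ** reflection u = A + outer_prod (((-2) *\<^sub>R A) *v u) u"
    unfolding scale outer_prod_scaleR_left
    by (simp add: reflection_def u matrix_diff_ldistrib matrix_mult_outer_prod matrix_scalar_ac
        outer_prod_scaleR_left flip: scaleR_matrix_vector_assoc)
  have HB: "reflection u ** B = B + outer_prod u (((-2) *\<^sub>R transpose B) *v u)"
    unfolding scale outer_prod_scaleR_right
    by (simp add: reflection_def u matrix_diff_rdistrib outer_prod_matrix_mult
        flip: scalar_matrix_assoc)
  have "A + reflection u ** B ** reflection u = (A ** reflection u + reflection u ** B) ** reflection u"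
    by (simp add: matrix_add_rdistrib flip: matrix_mul_assoc)
  then have "det (A + reflection u ** B ** reflection u) = - det (A ** reflection u + reflection u ** B)"
    by (simp add: det_mul det_reflection[OF \<open>u \<noteq> 0\<close>])
  then show ?thesis
    by (simp add: AH HB algebra_simps)
qed

lemma rotated_in_circle:
  fixes x y s :: real
  assumes s: "s\<^sup>2 = 3" and xy: "x\<^sup>2 + y\<^sup>2 = 1"
  shows "((x - s * y) / 2)\<^sup>2 + ((s * x + y) / 2)\<^sup>2 = 1"
    and "((- x - s * y) / 2)\<^sup>2 + ((s * x - y) / 2)\<^sup>2 = 1"
proof -
  have ss: "s * s = 3" "s * (s * z) = 3 * z" for z
    using s by (simp_all add: power2_eq_square flip: mult.assoc)
  have "((x - s * y) / 2)\<^sup>2 + ((s * x + y) / 2)\<^sup>2 = x\<^sup>2 + y\<^sup>2"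
    "((- x - s * y) / 2)\<^sup>2 + ((s * x - y) / 2)\<^sup>2 = x\<^sup>2 + y\<^sup>2"
    by (simp_all add: power2_eq_square algebra_simps add_divide_distrib diff_divide_distrib ss)
  with xy show "((x - s * y) / 2)\<^sup>2 + ((s * x + y) / 2)\<^sup>2 = 1"
    and "((- x - s * y) / 2)\<^sup>2 + ((s * x - y) / 2)\<^sup>2 = 1"
    by simp_all
qed

section \<open>Reflections in the vectors of a plane\<close>

locale orthonormal_pair =
  fixes p q :: "real ^ 'n"
  assumes pp: "p \<bullet> p = 1" and qq: "q \<bullet> q = 1" and pq: "p \<bullet> q = 0"
begin

definition refl2 :: "real \<Rightarrow> real \<Rightarrow> real ^ 'n ^ 'n" where
  "refl2 x y = reflection (x *\<^sub>R p + y *\<^sub>R q)"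

lemma inner_plane: "(x *\<^sub>R p + y *\<^sub>R q) \<bullet> (x' *\<^sub>R p + y' *\<^sub>R q) = x * x' + y * y'"
  by (simp add: inner_add_left inner_add_right pp qq pq inner_commute[of q p])

lemma hexagon_sum_det:
  fixes A B :: "real ^ 'n ^ 'n" and T :: "real \<Rightarrow> real \<Rightarrow> real"
  assumes T_def: "\<And>x y. T x y = det (A + refl2 x y ** B ** refl2 x y)"
    and s: "s\<^sup>2 = 3" and xy: "x\<^sup>2 + y\<^sup>2 = 1"
  shows "T x y + T ((x - s * y) / 2) ((s * x + y) / 2) + T ((- x - s * y) / 2) ((s * x - y) / 2) =
    T 1 0 + T (1 / 2) (s / 2) + T (- 1 / 2) (s / 2)"
proof -
  \<comment> \<open>\<open>f\<close> is polynomial on the whole plane; agreement with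
    \<open>T\<close> is claimed on the unit circle, where the reflection needs no
    normalisation.\<close>
  define f where "f x y = - det (A + B
      + outer_prod (((-2) *\<^sub>R A) *v (x *\<^sub>R p + y *\<^sub>R q)) (x *\<^sub>R p + y *\<^sub>R q)
      + outer_prod (x *\<^sub>R p + y *\<^sub>R q) (((-2) *\<^sub>R transpose B) *v (x *\<^sub>R p + y *\<^sub>R q)))" for x y
  have Tf: "T x y = f x y" if "x\<^sup>2 + y\<^sup>2 = 1" for x y
    unfolding T_def refl2_def f_def
    by (rule det_add_reflection_conjugate) (use that in \<open>simp add: inner_plane power2_eq_square\<close>)
  obtain c0 c1 c2 c3 c4 c5 c6 c7 c8 where c: "\<And>x y. f x y =
       - (c0 + (c1 * x\<^sup>2 + c2 * (x * y) + c3 * y\<^sup>2)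
         + (c4 * x ^ 4 + c5 * (x ^ 3 * y) + c6 * (x\<^sup>2 * y\<^sup>2) + c7 * (x * y ^ 3) + c8 * y ^ 4))"
    using det_rank_two_update_on_plane[of "A + B" "(-2) *\<^sub>R A" p q "(-2) *\<^sub>R transpose B"]
    unfolding f_def neg_equal_iff_equal by blast
  have sum: "f x y + f ((x - s * y) / 2) ((s * x + y) / 2) + f ((- x - s * y) / 2) ((s * x - y) / 2) =
      3 * (-c0) + 3 / 2 * (-c1 + -c3) + 3 / 8 * (3 * -c4 + -c6 + 3 * -c8)"
    if "x\<^sup>2 + y\<^sup>2 = 1" for x y
    by (rule quartic_hexagon_sum[OF _ s that, of f _ _ "-c2" _ _ "-c5" _ "-c7"]) (simp add: c)
  have 1: "(1::real)\<^sup>2 + 0\<^sup>2 = 1"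
    by simp
  show ?thesis
    using sum[OF xy] sum[OF 1] rotated_in_circle[OF s xy] rotated_in_circle[OF s 1] xy
    by (simp add: Tf)
qed

text \<open>
  A product of two reflections of the plane is a rotation that depends only on the angle between the two
  vectors; the last two hypotheses say that the cosines and the sines of the two angles agree.
\<close>
lemma refl2_mult_refl2:
  assumes ab: "a\<^sup>2 + b\<^sup>2 = 1" and cd: "c\<^sup>2 + d\<^sup>2 = 1"
    and ab': "a'\<^sup>2 + b'\<^sup>2 = 1" and cd': "c'\<^sup>2 + d'\<^sup>2 = 1"
    and cos: "a * c + b * d = a' * c' + b' * d'"
    and sin: "a * d - b * c = a' * d' - b' * c'"
  shows "refl2 a b ** refl2 c d = refl2 a' b' ** refl2 c' d'"
proof -
  have one: "refl2 a b *v v = v - (2 * (a * (p \<bullet> v) + b * (q \<bullet> v))) *\<^sub>R (a *\<^sub>R p + b *\<^sub>R q)"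
    if "a\<^sup>2 + b\<^sup>2 = 1" for a b v
  proof -
    have "(a *\<^sub>R p + b *\<^sub>R q) \<bullet> (a *\<^sub>R p + b *\<^sub>R q) = 1"
      using that by (simp only: inner_plane power2_eq_square)
    then show ?thesis
      by (simp only: refl2_def reflection_mult_vec) (simp add: inner_add_left)
  qed
  \<comment> \<open>With theta the angle from (a, b) to (c, d), the coefficients are cos (2 theta) -
    1 and, up to sign, sin (2 theta).\<close>
  have two: "refl2 a b *v (refl2 c d *v v) = v
     + (((a * c + b * d)\<^sup>2 - (a * d - b * c)\<^sup>2 - 1) * (p \<bullet> v) + 2 * (a * c + b * d) * (a * d - b * c) * (q \<bullet> v)) *\<^sub>R p
     + (((a * c + b * d)\<^sup>2 - (a * d - b * c)\<^sup>2 - 1) * (q \<bullet> v) - 2 * (a * c + b * d) * (a * d - b * c) * (p \<bullet> v)) *\<^sub>R q"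
    if ab: "a\<^sup>2 + b\<^sup>2 = 1" and cd: "c\<^sup>2 + d\<^sup>2 = 1" for a b c d v
  proof -
    define \<alpha> \<beta> k where "\<alpha> = p \<bullet> v" "\<beta> = q \<bullet> v" "k = 2 * (c * \<alpha> + d * \<beta>)"
    define l where "l = 2 * (a * (\<alpha> - k * c) + b * (\<beta> - k * d))"
    have "refl2 c d *v v = v - k *\<^sub>R (c *\<^sub>R p + d *\<^sub>R q)"
      using one[OF cd, of v] by (simp add: \<alpha>_\<beta>_k_def)
    moreover have "p \<bullet> (v - k *\<^sub>R (c *\<^sub>R p + d *\<^sub>R q)) = \<alpha> - k * c"
      "q \<bullet> (v - k *\<^sub>R (c *\<^sub>R p + d *\<^sub>R q)) = \<beta> - k * d"
      by (simp_all add: inner_diff_right inner_add_right pp qq pq inner_commute[of q p] \<alpha>_\<beta>_k_def(1,2))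
    ultimately have "refl2 a b *v (refl2 c d *v v) = v - k *\<^sub>R (c *\<^sub>R p + d *\<^sub>R q) - l *\<^sub>R (a *\<^sub>R p + b *\<^sub>R q)"
      using one[OF ab, of "refl2 c d *v v"] by (simp add: l_def)
    also have "\<dots> = v + (- k * c - l * a) *\<^sub>R p + (- k * d - l * b) *\<^sub>R q"
      by (simp add: algebra_simps)
    also have "- k * c - l * a = ((a * c + b * d)\<^sup>2 - (a * d - b * c)\<^sup>2 - 1) * \<alpha> + 2 * (a * c + b * d) * (a * d - b * c) * \<beta>"
      using ab cd \<alpha>_\<beta>_k_def(3) l_def by algebra
    also have "- k * d - l * b = ((a * c + b * d)\<^sup>2 - (a * d - b * c)\<^sup>2 - 1) * \<beta> - 2 * (a * c + b * d) * (a * d - b * c) * \<alpha>"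
      using ab cd \<alpha>_\<beta>_k_def(3) l_def by algebra
    finally show ?thesis
      by (simp add: \<alpha>_\<beta>_k_def)
  qed
  show ?thesis
    by (simp add: matrix_eq flip: matrix_vector_mul_assoc) (simp add: two ab cd ab' cd' cos sin)
qed

end

subsection \<open>Symmetries of the averaged determinant\<close>

definition det_sum :: "(real ^ 'n ^ 'n) set \<Rightarrow> real ^ 'n ^ 'n \<Rightarrow> real ^ 'n ^ 'n \<Rightarrow> real" where
  "det_sum S A B = (\<Sum>P\<in>S. det (A + P ** B ** transpose P))"

text \<open>\<open>S\<close> and \<open>A\<close> are fixed, but \<open>B\<close> ranges over all
  matrices: this is what makes the set closed under products and transposes.\<close>

definition det_sum_symmetries :: "(real ^ 'n ^ 'n) set \<Rightarrow> real ^ 'n ^ 'n \<Rightarrow> (real ^ 'n ^ 'n) set" where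
  "det_sum_symmetries S A =
     {Q. orthogonal_matrix Q \<and> (\<forall>B. det_sum S A (Q ** B ** transpose Q) = det_sum S A B)}"

lemma det_sum_symmetries_mult:
  assumes "P \<in> det_sum_symmetries S A" "Q \<in> det_sum_symmetries S A"
  shows "P ** Q \<in> det_sum_symmetries S A"
proof -
  have "P ** Q ** B ** transpose (P ** Q) = P ** (Q ** B ** transpose Q) ** transpose P" for B
    by (simp add: matrix_transpose_mul matrix_mul_assoc)
  then show ?thesis
    using assms by (simp add: det_sum_symmetries_def orthogonal_matrix_mul)
qed

lemma det_sum_symmetries_transpose:
  assumes "Q \<in> det_sum_symmetries S A"
  shows "transpose Q \<in> det_sum_symmetries S A"
proof -
  have Q: "orthogonal_matrix Q" and inv: "\<And>B. det_sum S A (Q ** B ** transpose Q) = det_sum S A B"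
    using assms by (simp_all add: det_sum_symmetries_def)
  have "Q ** (transpose Q ** B ** Q) ** transpose Q = (Q ** transpose Q) ** B ** (Q ** transpose Q)" for B
    by (simp add: matrix_mul_assoc)
  then have "Q ** (transpose Q ** B ** Q) ** transpose Q = B" for B
    using Q by (simp add: orthogonal_matrix_def)
  then show ?thesis
    using inv[of "transpose Q ** B ** Q" for B] Q by (simp add: det_sum_symmetries_def)
qed

text \<open>Moving \<open>P\<close> over to \<open>A\<close> lets \<open>hexagon_sum_det\<close>
  apply to each summand of \<open>det_sum\<close>, with \<open>transpose P ** A ** P\<close> in
  place of \<open>A\<close>.\<close>

lemma det_add_orthogonal_conjugate:
  fixes P :: "real ^ 'n ^ 'n"
  assumes P: "orthogonal_matrix P"
  shows "det (A + P ** N ** transpose P) = det (transpose P ** A ** P + N)"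
proof -
  have "P ** (transpose P ** A ** P + N) ** transpose P
      = (P ** transpose P) ** A ** (P ** transpose P) + P ** N ** transpose P"
    by (simp add: matrix_add_ldistrib matrix_add_rdistrib matrix_mul_assoc)
  then have "P ** (transpose P ** A ** P + N) ** transpose P = A + P ** N ** transpose P"
    using P by (simp add: orthogonal_matrix_def)
  then have "det (A + P ** N ** transpose P) = det (P ** (transpose P ** A ** P + N) ** transpose P)"
    by simp
  also have "\<dots> = det (transpose P ** A ** P + N)"
    using det_orthogonal_matrix[OF P] by (auto simp: det_mul)
  finally show ?thesis .
qed

lemma det_sum_symmetriesI:
  assumes H: "orthogonal_matrix H"
    and closed: "\<And>P. P \<in> S \<Longrightarrow> P ** H \<in> S" "\<And>P. P \<in> S \<Longrightarrow> P ** transpose H \<in> S"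
  shows "H \<in> det_sum_symmetries S A"
proof -
  have HH: "H ** transpose H = mat 1" "transpose H ** H = mat 1"
    using H by (simp_all add: orthogonal_matrix_def)
  have cancel: "P ** H ** transpose H = P" "P ** transpose H ** H = P" for P
    by (simp_all add: HH flip: matrix_mul_assoc)
  have "det_sum S A (H ** B ** transpose H) = det_sum S A B" for B
    unfolding det_sum_def
    by (rule sum.reindex_bij_witness[of S "\<lambda>P. P ** transpose H" "\<lambda>P. P ** H"])
       (simp_all add: closed matrix_transpose_mul cancel matrix_mul_assoc)
  then show ?thesis
    using H by (simp add: det_sum_symmetries_def)
qed

context orthonormal_pair
begin

text \<open>The hexagon identity equates three unknown sums with three known ones. On the known side
  the reflections are symmetries. On the other side each reflection is one of these symmetries times
  the common rotation \<open>K\<close>, so the three sums coincide.\<close>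

lemma refl2_in_symmetries:
  assumes S: "\<And>P. P \<in> S \<Longrightarrow> orthogonal_matrix P"
    and s: "s\<^sup>2 = 3" and xy: "x\<^sup>2 + y\<^sup>2 = 1"
    and closed: "\<And>P. P \<in> S \<Longrightarrow> P ** refl2 1 0 \<in> S"
      "\<And>P. P \<in> S \<Longrightarrow> P ** refl2 (1 / 2) (s / 2) \<in> S"
      "\<And>P. P \<in> S \<Longrightarrow> P ** refl2 (- 1 / 2) (s / 2) \<in> S"
  shows "refl2 x y \<in> det_sum_symmetries S A"
proof -
  have tr [simp]: "transpose (refl2 a b) = refl2 a b" for a b
    by (simp add: refl2_def)
  have orth [simp]: "orthogonal_matrix (refl2 a b)" for a b
    by (simp add: refl2_def)
  have self [simp]: "refl2 a b ** refl2 a b = mat 1" for a b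
    by (simp add: refl2_def)
  let ?G = "det_sum_symmetries S A"
  define K where "K = refl2 1 0 ** refl2 x y"
  have G: "refl2 1 0 \<in> ?G" "refl2 (1 / 2) (s / 2) \<in> ?G" "refl2 (- 1 / 2) (s / 2) \<in> ?G"
    using closed by (auto intro!: det_sum_symmetriesI)
  have step: "det_sum S A (refl2 c d ** B ** refl2 c d) = det_sum S A (K ** B ** transpose K)"
    if "refl2 a b \<in> ?G" "refl2 a b ** refl2 c d = K" for a b c d B
  proof -
    have "refl2 a b ** K = refl2 c d"
      by (simp add: matrix_mul_assoc flip: that(2))
    then have "refl2 c d = transpose (refl2 a b ** K)" "refl2 c d = refl2 a b ** K"
      by simp_all
    then have "refl2 c d ** B ** refl2 c d = refl2 a b ** (K ** B ** transpose K) ** transpose (refl2 a b)"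
      by (metis matrix_mul_assoc matrix_transpose_mul)
    then show ?thesis
      using that(1) by (simp add: det_sum_symmetries_def)
  qed
  have 1: "(1::real)\<^sup>2 + 0\<^sup>2 = 1" by simp
  have ss: "s * s = 3" "s * (s * z) = 3 * z" for z
    using s by (simp_all add: power2_eq_square flip: mult.assoc)
  note circle = rotated_in_circle[OF s xy] rotated_in_circle[OF s 1]
  \<comment> \<open>Both vectors are turned by the same angle, so the product of their reflections
    is still \<open>K\<close>.\<close>
  have K1: "refl2 (1 / 2) (s / 2) ** refl2 ((x - s * y) / 2) ((s * x + y) / 2) = K"
    unfolding K_def using xy circle
    by (intro refl2_mult_refl2) (simp_all add: ss algebra_simps add_divide_distrib diff_divide_distrib)
  have K2: "refl2 (- 1 / 2) (s / 2) ** refl2 ((- x - s * y) / 2) ((s * x - y) / 2) = K"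
    unfolding K_def using xy circle
    by (intro refl2_mult_refl2) (simp_all add: ss algebra_simps add_divide_distrib diff_divide_distrib)
  have "det_sum S A (refl2 x y ** B ** refl2 x y) = det_sum S A B" for B
  proof -
    define T where "T P a b = det (transpose P ** A ** P + refl2 a b ** B ** refl2 a b)" for P a b
    have T: "det_sum S A (refl2 a b ** B ** refl2 a b) = (\<Sum>P\<in>S. T P a b)" for a b
      by (auto simp: det_sum_def T_def det_add_orthogonal_conjugate S intro!: sum.cong)
    have fixed: "(\<Sum>P\<in>S. T P a b) = det_sum S A B" if "refl2 a b \<in> ?G" for a b
      using that by (simp flip: T) (simp add: det_sum_symmetries_def)
    have moved: "(\<Sum>P\<in>S. T P c d) = det_sum S A (refl2 x y ** B ** refl2 x y)"
      if "refl2 a b \<in> ?G" "refl2 a b ** refl2 c d = K" for a b c d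
      using step[OF that, of B] step[OF G(1) K_def[symmetric], of B] by (simp flip: T)
    have "(\<Sum>P\<in>S. T P x y + T P ((x - s * y) / 2) ((s * x + y) / 2) + T P ((- x - s * y) / 2) ((s * x - y) / 2))
        = (\<Sum>P\<in>S. T P 1 0 + T P (1 / 2) (s / 2) + T P (- 1 / 2) (s / 2))"
      by (intro sum.cong refl hexagon_sum_det[OF _ s xy]) (rule T_def)
    then have "3 * det_sum S A (refl2 x y ** B ** refl2 x y) = 3 * det_sum S A B"
      by (simp only: sum.distrib moved[OF G(1) K_def[symmetric]] moved[OF G(2) K1] moved[OF G(3) K2]
          fixed G)
    then show ?thesis by simp
  qed
  then show ?thesis
    by (simp add: det_sum_symmetries_def)
qed

end

subsection \<open>Generation of the orthogonal group by reflections\<close>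

lemma reflection_maps_to:
  assumes "norm a = norm x"
  shows "reflection (a - x) *v a = x"
proof (cases "a = x")
  case True
  then show ?thesis by (simp add: reflection_mult_vec)
next
  case False
  have "a \<bullet> a = x \<bullet> x"
    using assms by (simp add: norm_eq)
  then have "2 * ((a - x) \<bullet> a) = (a - x) \<bullet> (a - x)"
    by (simp add: algebra_simps inner_commute)
  with False show ?thesis
    by (simp add: reflection_mult_vec)
qed

lemma reflection_fixes_orthogonal: "u \<bullet> x = 0 \<Longrightarrow> reflection u *v x = x"
  by (simp add: reflection_mult_vec)

text \<open>
  Cartan--Dieudonne: composing \<open>Q\<close> with the reflection that maps \<open>Q x\<close> to \<open>x\<close> enlarges the space of
  fixed vectors.
\<close>
theorem orthogonal_matrix_in_reflection_closed:
  fixes Q :: "real ^ 'n ^ 'n"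
  assumes "orthogonal_matrix Q"
    and gen: "\<And>u. reflection u \<in> G" and mult: "\<And>P R. P \<in> G \<Longrightarrow> R \<in> G \<Longrightarrow> P ** R \<in> G"
  shows "Q \<in> G"
  using assms(1)
proof (induction "DIM(real ^ 'n) - dim {y. Q *v y = y}" arbitrary: Q rule: less_induct)
  case less
  note Q = \<open>orthogonal_matrix Q\<close>
  show ?case
  proof (cases "Q = mat 1")
    case True
    moreover have "reflection 0 = (mat 1 :: real ^ 'n ^ 'n)"
      by (simp add: reflection_def)
    ultimately show ?thesis
      using gen by metis
  next
    case False
    then obtain x where x: "Q *v x \<noteq> x"
      by (metis matrix_eq matrix_vector_mul_lid)
    define u where "u = Q *v x - x"
    define R where "R = reflection u ** Q"
    have Qi: "(Q *v a) \<bullet> (Q *v b) = a \<bullet> b" for a b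
      using orthogonal_matrix_vec_inner[OF Q] .
    have sub: "subspace {y. M *v y = y}" for M :: "real ^ 'n ^ 'n"
      by (simp add: subspace_def matrix_vector_right_distrib matrix_vector_mult_scaleR)
    have "R *v y = y" if "Q *v y = y" for y
    proof -
      have "u \<bullet> y = 0"
        using Qi[of x y] that by (simp add: u_def inner_diff_left)
      then show ?thesis
        by (simp add: R_def that reflection_fixes_orthogonal flip: matrix_vector_mul_assoc)
    qed
    moreover have "R *v x = x"
      using reflection_maps_to[of "Q *v x" x] Qi[of x x]
      by (simp add: R_def u_def norm_eq flip: matrix_vector_mul_assoc)
    ultimately have "{y. Q *v y = y} \<subset> {y. R *v y = y}"
      using x by auto
    then have "dim {y. Q *v y = y} < dim {y. R *v y = y}"
      using subspace_dim_equal[OF sub sub, of Q R] not_less by blast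
    moreover have "dim {y. R *v y = y} \<le> DIM(real ^ 'n)"
      by (rule dim_subset_UNIV)
    ultimately have "R \<in> G"
      using Q by (intro less.hyps) (auto simp: R_def orthogonal_matrix_mul)
    moreover have "Q = reflection u ** R"
      by (simp add: R_def matrix_mul_assoc)
    ultimately show ?thesis
      using gen mult by simp
  qed
qed

subsection \<open>The simplex group\<close>

text \<open>Summing the squared distances from one vertex, with the vertices adding up to zero,
  shows that all vertices have equal norm. Then all inner products of distinct vertices agree, and
  the rest is expansion.\<close>

lemma simplex_inner:
  fixes V :: "(real ^ 'd) set"
  assumes V: "centered_regular_simplex V"
  obtains r where "r > 0"
    "\<And>i j. i \<in> V \<Longrightarrow> j \<in> V \<Longrightarrow> i \<bullet> i = j \<bullet> j"
    "\<And>i j. i \<in> V \<Longrightarrow> j \<in> V \<Longrightarrow> i \<noteq> j \<Longrightarrow> (i - j) \<bullet> (i - j) = r\<^sup>2"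
    "\<And>i j k. i \<in> V \<Longrightarrow> j \<in> V \<Longrightarrow> k \<in> V \<Longrightarrow> i \<noteq> j \<Longrightarrow> i \<noteq> k \<Longrightarrow> j \<noteq> k \<Longrightarrow>
       (i - j) \<bullet> (i - k) = r\<^sup>2 / 2"
    "\<And>i j k. i \<in> V \<Longrightarrow> j \<in> V \<Longrightarrow> k \<in> V \<Longrightarrow> i \<noteq> k \<Longrightarrow> j \<noteq> k \<Longrightarrow> (i - j) \<bullet> k = 0"
proof -
  have card: "card V = CARD('d) + 1" and sum: "(\<Sum>x\<in>V. x) = 0"
    using V by (simp_all add: centered_regular_simplex_def)
  obtain r where r: "\<And>x y. x \<in> V \<Longrightarrow> y \<in> V \<Longrightarrow> x \<noteq> y \<Longrightarrow> dist x y = r"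
    using V by (auto simp: centered_regular_simplex_def)
  have fin: "finite V"
    using card by (metis Suc_eq_plus1 card.infinite nat.distinct(1))
  have "1 < card V"
    using card by simp
  then obtain a b where "a \<in> V" "b \<in> V" "a \<noteq> b"
    by (metis One_nat_def card_le_Suc0_iff_eq fin not_less)
  then have "r > 0"
    using r by (metis zero_less_dist_iff)
  have edge: "(i - j) \<bullet> (i - j) = r\<^sup>2" if "i \<in> V" "j \<in> V" "i \<noteq> j" for i j
    using r[OF that] by (simp add: dist_norm dot_square_norm)
  have norm: "(card V) * (x \<bullet> x) + (\<Sum>y\<in>V. y \<bullet> y) = (card V - 1) * r\<^sup>2" if "x \<in> V" for x
  proof -
    have "(\<Sum>y\<in>V. (x - y) \<bullet> (x - y)) = (\<Sum>y\<in>V. x \<bullet> x + y \<bullet> y - 2 * (x \<bullet> y))"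
      by (intro sum.cong) (auto simp: algebra_simps inner_commute)
    also have "\<dots> = card V * (x \<bullet> x) + (\<Sum>y\<in>V. y \<bullet> y) - 2 * (x \<bullet> (\<Sum>y\<in>V. y))"
      by (simp add: sum.distrib sum_subtractf inner_sum_right sum_distrib_left)
    also have "(\<Sum>y\<in>V. (x - y) \<bullet> (x - y)) = (\<Sum>y\<in>V - {x}. (x - y) \<bullet> (x - y))"
      using fin that by (simp add: sum.remove)
    also have "\<dots> = (\<Sum>y\<in>V - {x}. r\<^sup>2)"
      using that by (intro sum.cong) (auto simp: edge)
    finally show ?thesis
      using that fin by (simp add: sum)
  qed
  have same_norm: "x \<bullet> x = y \<bullet> y" if "x \<in> V" "y \<in> V" for x y
  proof -
    have "card V * (x \<bullet> x) = card V * (y \<bullet> y)"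
      using norm[OF that(1)] norm[OF that(2)] by linarith
    then show ?thesis
      using card by simp
  qed
  have inner: "2 * (i \<bullet> j) = 2 * (i \<bullet> i) - r\<^sup>2" if "i \<in> V" "j \<in> V" "i \<noteq> j" for i j
    using edge[OF that] same_norm[OF that(1,2)] by (simp add: algebra_simps inner_commute)
  have tri: "(i - j) \<bullet> (i - k) = r\<^sup>2 / 2"
    if "i \<in> V" "j \<in> V" "k \<in> V" "i \<noteq> j" "i \<noteq> k" "j \<noteq> k" for i j k
    using inner[of i j] inner[of i k] inner[of j k] same_norm[of i j] that
    by (simp add: algebra_simps inner_commute)
  have orth: "(i - j) \<bullet> k = 0"
    if "i \<in> V" "j \<in> V" "k \<in> V" "i \<noteq> k" "j \<noteq> k" for i j k
    using inner[of i k] inner[of j k] same_norm[of i j] that by (simp add: algebra_simps)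
  show ?thesis
    using that[OF \<open>r > 0\<close> same_norm edge tri orth] by blast
qed

lemma simplex_group_mult:
  assumes "centered_regular_simplex V" "P \<in> simplex_group V" "R \<in> simplex_group V"
  shows "P ** R \<in> simplex_group V"
proof -
  have "(\<lambda>x. (P ** R) *v x) ` V = (\<lambda>x. P *v x) ` (\<lambda>x. R *v x) ` V"
    by (simp add: image_image matrix_vector_mul_assoc)
  then show ?thesis
    using assms by (simp add: simplex_group_iff_permutes_vertices orthogonal_matrix_mul)
qed

text \<open>The edge is orthogonal to all other vertices and its ends have equal norm, so the
  reflection swaps the ends and fixes the rest. The case \<open>i = j\<close> is included and yields
  the identity.\<close>

lemma reflection_edge_in_simplex_group:
  fixes V :: "(real ^ 'd) set"
  assumes V: "centered_regular_simplex V" and ij: "i \<in> V" "j \<in> V"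
  shows "reflection (i - j) \<in> simplex_group V"
proof -
  obtain r where norms: "\<And>i j. i \<in> V \<Longrightarrow> j \<in> V \<Longrightarrow> i \<bullet> i = j \<bullet> j"
    and orth: "\<And>i j k. i \<in> V \<Longrightarrow> j \<in> V \<Longrightarrow> k \<in> V \<Longrightarrow> i \<noteq> k \<Longrightarrow> j \<noteq> k \<Longrightarrow> (i - j) \<bullet> k = 0"
    by (rule simplex_inner[OF V]) blast
  let ?f = "\<lambda>x. reflection (i - j) *v x"
  have invol: "?f (?f x) = x" for x
    by (simp add: matrix_vector_mul_assoc)
  have "?f x \<in> V" if "x \<in> V" for x
  proof (cases "x = i \<or> x = j")
    case True
    have "norm i = norm j"
      using norms[OF ij] by (simp add: norm_eq)
    then have "?f i = j"
      by (rule reflection_maps_to)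
    then show ?thesis
      using True ij invol[of i] by auto
  next
    case False
    then have "?f x = x"
      using that ij by (intro reflection_fixes_orthogonal orth) auto
    then show ?thesis
      using that by simp
  qed
  then have "?f ` V = V"
    using invol by (metis image_subset_iff subsetI subset_antisym imageI)
  then show ?thesis
    by (simp add: simplex_group_iff_permutes_vertices[OF V])
qed

lemma span_simplex:
  fixes V :: "(real ^ 'd) set"
  assumes V: "centered_regular_simplex V"
  shows "span V = UNIV"
proof -
  have "affine hull V = UNIV"
    using V by (intro affine_independent_span_eq) (auto simp: centered_regular_simplex_def)
  then show ?thesis
    using affine_hull_subset_span[of V] by auto
qed

lemma orthogonal_simplex_group: "P \<in> simplex_group V \<Longrightarrow> orthogonal_matrix P"
  by (simp add: simplex_group_def)

lemma reflection_edge_in_symmetries: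
  assumes V: "centered_regular_simplex V" and "i \<in> V" "j \<in> V"
  shows "reflection (i - j) \<in> det_sum_symmetries (simplex_group V) A"
  using simplex_group_mult[OF V _ reflection_edge_in_simplex_group[OF assms]]
  by (intro det_sum_symmetriesI) simp_all

text \<open>In coordinates adapted to the face its edges point in the directions of 0, 60 and 120
  degrees, the reference triple of \<open>refl2_in_symmetries\<close>.\<close>

lemma reflection_face_in_symmetries:
  fixes V :: "(real ^ 'd) set"
  assumes V: "centered_regular_simplex V"
    and ijk: "i \<in> V" "j \<in> V" "k \<in> V" "i \<noteq> j" "i \<noteq> k" "j \<noteq> k"
  shows "reflection (\<alpha> *\<^sub>R (i - j) + \<beta> *\<^sub>R (i - k)) \<in> det_sum_symmetries (simplex_group V) A"
proof (cases "\<alpha> *\<^sub>R (i - j) + \<beta> *\<^sub>R (i - k) = 0")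
  case True
  then show ?thesis
    using reflection_edge_in_symmetries[OF V ijk(1,1)] by simp
next
  case False
  obtain r where r: "r > 0"
    and edge: "\<And>i j. i \<in> V \<Longrightarrow> j \<in> V \<Longrightarrow> i \<noteq> j \<Longrightarrow> (i - j) \<bullet> (i - j) = r\<^sup>2"
    and tri: "\<And>i j k. i \<in> V \<Longrightarrow> j \<in> V \<Longrightarrow> k \<in> V \<Longrightarrow> i \<noteq> j \<Longrightarrow> i \<noteq> k \<Longrightarrow> j \<noteq> k \<Longrightarrow>
       (i - j) \<bullet> (i - k) = r\<^sup>2 / 2"
    by (rule simplex_inner[OF V]) blast
  define s :: real where "s = sqrt 3"
  have s: "s\<^sup>2 = 3" "s \<noteq> 0"
    by (simp_all add: s_def)
  define e f where "e = i - j" and "f = i - k"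
  have ee: "e \<bullet> e = r\<^sup>2" and ff: "f \<bullet> f = r\<^sup>2" and ef: "e \<bullet> f = r\<^sup>2 / 2"
    unfolding e_def f_def using edge tri ijk by auto
  \<comment> \<open>Gram-Schmidt: \<open>2 *\<^sub>R f - e\<close> is orthogonal to \<open>e\<close>
    and has norm \<open>r * s\<close>.\<close>
  define p q where "p = (1 / r) *\<^sub>R e" and "q = (1 / (r * s)) *\<^sub>R (2 *\<^sub>R f - e)"
  interpret orthonormal_pair p q
  proof
    show "p \<bullet> p = 1"
      using r by (simp add: p_def ee power2_eq_square)
    have "(2 *\<^sub>R f - e) \<bullet> (2 *\<^sub>R f - e) = (r * s)\<^sup>2"
      using s(1) by (simp add: inner_diff_left inner_diff_right inner_commute[of f e] ee ff ef power_mult_distrib)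
    then show "q \<bullet> q = 1"
      using r s(2) by (simp add: q_def power2_eq_square)
    show "p \<bullet> q = 0"
      by (simp add: p_def q_def inner_diff_right ee ef)
  qed
  have e: "e = r *\<^sub>R p" and f: "f = (r / 2) *\<^sub>R p + (r * s / 2) *\<^sub>R q"
    using r s(2) by (simp_all add: p_def q_def scaleR_diff_right)
  have r1: "refl2 1 0 = reflection (i - j)"
    using r reflection_scaleR[of r p] by (simp add: refl2_def e flip: e_def)
  have r0: "r \<noteq> 0"
    using r by simp
  have f': "f = r *\<^sub>R ((1 / 2) *\<^sub>R p + (s / 2) *\<^sub>R q)" and fe: "f - e = r *\<^sub>R ((- 1 / 2) *\<^sub>R p + (s / 2) *\<^sub>R q)"
    unfolding f by (simp_all add: e vec_eq_iff algebra_simps)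
  have r2: "refl2 (1 / 2) (s / 2) = reflection (i - k)"
    by (simp only: refl2_def f' reflection_scaleR[OF r0] flip: f_def)
  have "j - k = f - e"
    by (simp add: e_def f_def)
  then have r3: "refl2 (- 1 / 2) (s / 2) = reflection (j - k)"
    by (simp only: refl2_def fe reflection_scaleR[OF r0])
  \<comment> \<open>A reflection depends only on the line of its vector, so dividing by
    \<open>n\<close> reduces to the unit circle.\<close>
  define a b n where "a = \<alpha> * r + \<beta> * r / 2" and "b = \<beta> * r * s / 2"
    and "n = norm (\<alpha> *\<^sub>R (i - j) + \<beta> *\<^sub>R (i - k))"
  have n: "n > 0"
    using False by (simp add: n_def)
  have w: "\<alpha> *\<^sub>R (i - j) + \<beta> *\<^sub>R (i - k) = a *\<^sub>R p + b *\<^sub>R q"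
    by (simp add: a_def b_def e f algebra_simps flip: e_def f_def)
  then have "n\<^sup>2 = a\<^sup>2 + b\<^sup>2"
    by (simp add: n_def power2_norm_eq_inner inner_plane) (simp add: power2_eq_square)
  then have "(a / n)\<^sup>2 + (b / n)\<^sup>2 = 1"
    using n by (metis add_divide_distrib divide_self less_irrefl power_divide zero_eq_power2)
  then have "refl2 (a / n) (b / n) \<in> det_sum_symmetries (simplex_group V) A"
    by (intro refl2_in_symmetries[OF orthogonal_simplex_group s(1)])
       (simp_all only: r1 r2 r3 simplex_group_mult[OF V] reflection_edge_in_simplex_group[OF V] ijk)
  moreover have "a *\<^sub>R p + b *\<^sub>R q = n *\<^sub>R ((a / n) *\<^sub>R p + (b / n) *\<^sub>R q)"
    using n by (simp add: scaleR_add_right)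
  ultimately show ?thesis
    using n by (metis w refl2_def reflection_scaleR less_irrefl)
qed

section \<open>Continuity and compactness\<close>

lemma continuous_on_det_conjugate:
  fixes A B :: "real ^ 'n ^ 'n"
  shows "continuous_on X (\<lambda>Q. det (A + Q ** B ** transpose Q))"
  unfolding det_def matrix_matrix_mult_def transpose_def
  by (auto intro!: continuous_intros)

lemma compact_orthogonal_group: "compact (orthogonal_group :: (real ^ 'n ^ 'n) set)"
proof (rule compact_eq_bounded_closed[THEN iffD2], rule conjI)
  have "norm Q \<le> CARD('n)" if "Q \<in> orthogonal_group" for Q :: "real ^ 'n ^ 'n"
  proof -
    have "norm (Q $ i) = 1" for i
      using that by (simp add: orthogonal_group_def orthogonal_matrix_orthonormal_rows row_def)
    moreover have "norm Q \<le> (\<Sum>i\<in>UNIV. norm (Q $ i))"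
      unfolding norm_vec_def by (rule L2_set_le_sum) simp
    ultimately show ?thesis
      by simp
  qed
  then show "bounded (orthogonal_group :: (real ^ 'n ^ 'n) set)"
    unfolding bounded_iff by blast
  have "continuous_on UNIV (\<lambda>Q :: real ^ 'n ^ 'n. transpose Q ** Q)"
    unfolding matrix_matrix_mult_def transpose_def by (auto intro!: continuous_intros)
  then have "closed ((\<lambda>Q :: real ^ 'n ^ 'n. transpose Q ** Q) -` {mat 1})"
    by (intro continuous_closed_vimage) (auto simp: continuous_on_eq_continuous_at)
  then show "closed (orthogonal_group :: (real ^ 'n ^ 'n) set)"
    by (simp add: orthogonal_group_def orthogonal_matrix vimage_def)
qed

text \<open>Supplies the maximiser in \<open>det_sum_symmetries_simplex_group\<close>. The set is
  cut out of the orthogonal group by closed conditions, one for each \<open>B\<close>.\<close>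

lemma compact_det_sum_symmetries:
  "compact (det_sum_symmetries S A :: (real ^ 'n ^ 'n) set)"
proof -
  have "continuous_on UNIV (\<lambda>Q. det_sum S A (Q ** B ** transpose Q))" for B :: "real ^ 'n ^ 'n"
    unfolding det_sum_def det_def matrix_matrix_mult_def transpose_def
    by (auto intro!: continuous_intros)
  then have "closed (\<Inter>B. {Q. det_sum S A (Q ** B ** transpose Q) = det_sum S A B})"
    by (intro closed_INT ballI closed_Collect_eq continuous_on_const)
  then have "compact (orthogonal_group \<inter> (\<Inter>B. {Q. det_sum S A (Q ** B ** transpose Q) = det_sum S A B}))"
    by (intro compact_Int_closed compact_orthogonal_group)
  moreover have "orthogonal_group \<inter> (\<Inter>B. {Q. det_sum S A (Q ** B ** transpose Q) = det_sum S A B})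
      = det_sum_symmetries S A"
    by (auto simp: det_sum_symmetries_def orthogonal_group_def)
  ultimately show ?thesis by simp
qed

section \<open>Invariance under the whole orthogonal group\<close>

theorem det_sum_symmetries_simplex_group:
  fixes V :: "(real ^ 'd) set" and Q :: "real ^ 'd ^ 'd"
  assumes V: "centered_regular_simplex V" and Q: "orthogonal_matrix Q"
  shows "Q \<in> det_sum_symmetries (simplex_group V) A"
proof (rule orthogonal_matrix_in_reflection_closed[OF Q])
  let ?G = "det_sum_symmetries (simplex_group V) A"
  show "P ** R \<in> ?G" if "P \<in> ?G" "R \<in> ?G" for P R
    using that by (rule det_sum_symmetries_mult)
  fix u :: "real ^ 'd"
  obtain r where r: "r > 0"
    and edge: "\<And>i j. i \<in> V \<Longrightarrow> j \<in> V \<Longrightarrow> i \<noteq> j \<Longrightarrow> (i - j) \<bullet> (i - j) = r\<^sup>2"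
    and tri: "\<And>i j k. i \<in> V \<Longrightarrow> j \<in> V \<Longrightarrow> k \<in> V \<Longrightarrow> i \<noteq> j \<Longrightarrow> i \<noteq> k \<Longrightarrow> j \<noteq> k \<Longrightarrow>
       (i - j) \<bullet> (i - k) = r\<^sup>2 / 2"
    by (rule simplex_inner[OF V]) blast
  have card: "card V = CARD('d) + 1" and sum: "(\<Sum>x\<in>V. x) = 0"
    using V by (simp_all add: centered_regular_simplex_def)
  have fin: "finite V"
    using card by (metis Suc_eq_plus1 card.infinite nat.distinct(1))
  have "1 < card V"
    using card by simp
  then obtain i j where ij: "i \<in> V" "j \<in> V" "i \<noteq> j"
    by (metis One_nat_def card_le_Suc0_iff_eq fin not_less)
  define e where "e = i - j"
  have ee: "e \<bullet> e = r\<^sup>2"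
    using edge ij by (simp add: e_def)
  have e_refl: "reflection e \<in> ?G"
    unfolding e_def by (rule reflection_edge_in_symmetries[OF V ij(1,2)])
  have "continuous_on ?G (\<lambda>Q. (Q *v u) \<bullet> e)"
    unfolding matrix_vector_mult_def by (auto intro!: continuous_intros)
  then obtain Q where Q: "Q \<in> ?G" and max: "\<And>R. R \<in> ?G \<Longrightarrow> (R *v u) \<bullet> e \<le> (Q *v u) \<bullet> e"
    using continuous_attains_sup[OF compact_det_sum_symmetries, of "simplex_group V" A] e_refl by blast
  \<comment> \<open>Maximality under the reflections in the planes of the faces containing \<open>i\<close> and \<open>j\<close> forces \<open>z\<close>
      to be parallel to \<open>e\<close>.\<close>
  define z where "z = Q *v u"
  have orthQ: "orthogonal_matrix Q"
    using Q by (simp add: det_sum_symmetries_def)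
  \<comment> \<open>Reflecting \<open>z\<close> in \<open>w\<close> changes its inner product with
    \<open>e\<close> by -2 (w . z) (w . e) / (w . w), which cannot be positive at a maximum.\<close>
  have max_reflection: "(w \<bullet> z) * (w \<bullet> e) \<ge> 0" if "reflection w \<in> ?G" for w
  proof (cases "w = 0")
    case False
    have "(reflection w *v z) \<bullet> e \<le> z \<bullet> e"
      using max[OF det_sum_symmetries_mult[OF that Q]] by (simp add: z_def matrix_vector_mul_assoc)
    then have "2 * (w \<bullet> z) / (w \<bullet> w) * (w \<bullet> e) \<ge> 0"
      by (simp add: reflection_mult_vec inner_diff_left)
    moreover have "w \<bullet> w > 0"
      using False by simp
    ultimately show ?thesis
      by (simp add: zero_le_divide_iff mult.commute)
  qed simp
  define l where "l = (z \<bullet> e) / r\<^sup>2"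
  have le: "l * r\<^sup>2 = z \<bullet> e"
    using r by (simp add: l_def)
  have perp_edge: "(z - l *\<^sub>R e) \<bullet> (i - k) = 0" if "k \<in> V" for k
  proof -
    consider "k = i" | "k = j" | "k \<noteq> i" "k \<noteq> j" by blast
    then show ?thesis
    proof cases
      case 2
      then show ?thesis
        by (simp add: inner_diff_left ee le flip: e_def)
    next
      case 3
      \<comment> \<open>\<open>t\<close> is the inner product of \<open>z - l *\<^sub>R e\<close>
        and \<open>i - k\<close>, the number that has to vanish.\<close>
      define t where "t = z \<bullet> (i - k) - (z \<bullet> e) / 2"
      have ek: "e \<bullet> (i - k) = r\<^sup>2 / 2"
        unfolding e_def using tri ij 3 that by metis
      \<comment> \<open>This vector has \<open>w \<bullet> e = t * r\<^sup>2\<close> and \<open>w \<bullet> z = - t\<close>, so maximality gives \<open>t = 0\<close>.\<close>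
      define y where "y = - (z \<bullet> e) - 1"
      define w where "w = (t - y / 2) *\<^sub>R (i - j) + y *\<^sub>R (i - k)"
      have "reflection w \<in> ?G"
        unfolding w_def using reflection_face_in_symmetries[OF V] ij that 3 by metis
      then have "(w \<bullet> z) * (w \<bullet> e) \<ge> 0"
        by (rule max_reflection)
      moreover have "w \<bullet> e = t * r\<^sup>2"
      proof -
        have "w \<bullet> e = (t - y / 2) * (e \<bullet> e) + y * (e \<bullet> (i - k))"
          unfolding w_def e_def[symmetric] by (simp add: inner_add_left inner_commute[of "i - k"])
        also have "\<dots> = t * r\<^sup>2"
          unfolding ee ek by (simp add: algebra_simps)
        finally show ?thesis .
      qed
      \<comment> \<open>The inner product comes to \<open>t * (z \<bullet> e + y)\<close>, which
        explains the choice of \<open>y\<close>.\<close>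
      moreover have "w \<bullet> z = - t"
      proof -
        have "w \<bullet> z = (t - y / 2) * (z \<bullet> e) + y * (z \<bullet> (i - k))"
          unfolding w_def e_def[symmetric]
          by (simp add: inner_add_left inner_commute[of "i - k"] inner_commute[of e])
        also have "z \<bullet> (i - k) = t + (z \<bullet> e) / 2"
          by (simp add: t_def)
        finally show ?thesis
          by (simp add: y_def algebra_simps)
      qed
      ultimately have "- (t * t * r\<^sup>2) \<ge> 0"
        by (simp add: mult.assoc)
      then have "t = 0"
        using r by (auto simp: mult_le_0_iff)
      then show ?thesis
        using le by (simp add: inner_diff_left ek t_def)
    qed simp
  qed
  \<comment> \<open>Orthogonal to all edges at \<open>i\<close>, the vector has equal inner products
    with all vertices, and these add up to zero.\<close>
  have "(z - l *\<^sub>R e) \<bullet> x = 0" if "x \<in> V" for x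
  proof -
    let ?z = "z - l *\<^sub>R e"
    have const: "?z \<bullet> k = ?z \<bullet> i" if "k \<in> V" for k
      using perp_edge[OF that] by (simp add: inner_diff_right)
    have "0 = (\<Sum>k\<in>V. ?z \<bullet> k)"
      by (simp add: sum flip: inner_sum_right)
    also have "\<dots> = card V * (?z \<bullet> i)"
      by (simp add: const)
    finally show ?thesis
      using const[OF that] card by simp
  qed
  then have "(z - l *\<^sub>R e) \<bullet> x = 0" for x
    using span_simplex[OF V] orthogonal_to_span[of x V "z - l *\<^sub>R e"] by (simp add: orthogonal_def)
  then have z: "z = l *\<^sub>R e"
    using inner_eq_zero_iff by fastforce
  have "reflection z \<in> ?G"
  proof (cases "l = 0")
    case True
    \<comment> \<open>Here \<open>z = 0\<close>, and \<open>i - i\<close> supplies the identity as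
      \<open>reflection 0\<close>.\<close>
    have "reflection (i - i) \<in> ?G"
      by (rule reflection_edge_in_symmetries[OF V ij(1) ij(1)])
    then show ?thesis
      using True by (simp add: z)
  next
    case False
    then show ?thesis
      using e_refl by (simp add: z reflection_scaleR)
  qed
  then have "transpose Q ** reflection z ** Q \<in> ?G"
    by (intro det_sum_symmetries_mult det_sum_symmetries_transpose Q)
  moreover have "u = transpose Q *v z"
    using orthQ by (simp add: z_def matrix_vector_mul_assoc orthogonal_matrix_def del: transpose_matrix_vector)
  then have "reflection u = transpose Q ** reflection z ** Q"
    using reflection_conjugate[of "transpose Q" z] orthQ by simp
  ultimately show "reflection u \<in> ?G"
    by simp
qed

section \<open>Averaging over Haar measure\<close>

theorem theorem4p2:
  fixes A B :: "real ^ 'd ^ 'd"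
    and V :: "(real ^ 'd) set"
    and \<mu> :: "(real ^ 'd ^ 'd) measure"
  assumes "centered_regular_simplex V"
    and "haar_orthogonal \<mu>"
    and "transpose A = A"
    and "transpose B = B"
  shows "measure_pmf.expectation (pmf_of_set (simplex_group V))
           (\<lambda>P. det (A + P ** B ** transpose P))
       = (\<integral>Q. det (A + Q ** B ** transpose Q) \<partial>\<mu>)"
proof -
  let ?S = "simplex_group V" and ?O = "orthogonal_group :: (real ^ 'd ^ 'd) set"
  define f where "f Q = det (A + Q ** B ** transpose Q)" for Q
  interpret prob_space \<mu>
    using assms(2) by (simp add: haar_orthogonal_def)
  have sets: "sets \<mu> = sets (restrict_space borel ?O)"
    and inv: "\<And>R. R \<in> ?O \<Longrightarrow> distr \<mu> \<mu> (\<lambda>Q. R ** Q) = \<mu>"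
    using assms(2) by (simp_all add: haar_orthogonal_def)
  have space: "space \<mu> = ?O"
    using sets_eq_imp_space_eq[OF sets] by (simp add: space_restrict_space)
  have cont: "continuous_on ?O f"
    unfolding f_def by (rule continuous_on_det_conjugate)
  have f_meas: "f \<in> borel_measurable \<mu>"
    using borel_measurable_continuous_on_restrict[OF cont] measurable_cong_sets[OF sets refl] by blast
  have mult_meas: "(\<lambda>Q. R ** Q) \<in> measurable \<mu> \<mu>" if "R \<in> ?O" for R
  proof -
    have "continuous_on ?O (\<lambda>Q. R ** Q)"
      unfolding matrix_matrix_mult_def by (auto intro!: continuous_intros)
    then have "(\<lambda>Q. R ** Q) \<in> measurable (restrict_space borel ?O) (restrict_space borel ?O)"
      using that by (intro measurable_restrict_space2 borel_measurable_continuous_on_restrict)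
        (auto simp: space_restrict_space orthogonal_group_def orthogonal_matrix_mul)
    then show ?thesis
      using measurable_cong_sets[OF sets sets] by blast
  qed
  have f_shift: "(\<integral>Q. f (R ** Q) \<partial>\<mu>) = (\<integral>Q. f Q \<partial>\<mu>)" if "R \<in> ?O" for R
    using integral_distr[OF mult_meas[OF that] f_meas] inv[OF that] by simp
  \<comment> \<open>Continuity on a compact group gives the bound from which integrability
    follows.\<close>
  obtain C where C: "\<And>Q. Q \<in> ?O \<Longrightarrow> norm (f Q) \<le> C"
    using compact_imp_bounded[OF compact_continuous_image[OF cont compact_orthogonal_group]]
    by (auto simp: bounded_iff)
  have f_int: "integrable \<mu> (\<lambda>Q. f (R ** Q))" if "R \<in> ?O" for R
  proof (rule integrable_const_bound)
    show "AE Q in \<mu>. norm (f (R ** Q)) \<le> C"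
      using that by (intro AE_I2 C) (simp add: space orthogonal_group_def orthogonal_matrix_mul)
    show "(\<lambda>Q. f (R ** Q)) \<in> borel_measurable \<mu>"
      using measurable_compose[OF mult_meas[OF that] f_meas] .
  qed
  have S: "?S \<subseteq> ?O" "finite ?S" "?S \<noteq> {}"
  proof -
    show "?S \<subseteq> ?O"
      using orthogonal_simplex_group by (auto simp: orthogonal_group_def)
    show "finite ?S"
      by (rule finite_simplex_group[OF assms(1)])
    have "mat 1 \<in> ?S"
      by (simp add: simplex_group_def orthogonal_matrix_id)
    then show "?S \<noteq> {}" by blast
  qed
  \<comment> \<open>By invariance the constant \<open>det_sum\<close> can be rewritten, at each
    \<open>Q\<close>, as a sum of left translates of \<open>f\<close>, all with the same
    integral.\<close>
  have "det_sum ?S A B = (\<integral>Q. det_sum ?S A B \<partial>\<mu>)"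
    by (simp add: prob_space)
  also have "\<dots> = (\<integral>Q. (\<Sum>P\<in>?S. f (P ** Q)) \<partial>\<mu>)"
  proof (rule Bochner_Integration.integral_cong[OF refl])
    fix Q assume "Q \<in> space \<mu>"
    then have "Q \<in> det_sum_symmetries ?S A"
      using det_sum_symmetries_simplex_group[OF assms(1)] by (simp add: space orthogonal_group_def)
    then have "det_sum ?S A B = det_sum ?S A (Q ** B ** transpose Q)"
      by (simp add: det_sum_symmetries_def)
    then show "det_sum ?S A B = (\<Sum>P\<in>?S. f (P ** Q))"
      by (simp add: det_sum_def f_def matrix_transpose_mul matrix_mul_assoc)
  qed
  also have "\<dots> = (\<Sum>P\<in>?S. \<integral>Q. f (P ** Q) \<partial>\<mu>)"
    using S(1) by (intro Bochner_Integration.integral_sum f_int) auto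
  also have "\<dots> = card ?S * (\<integral>Q. f Q \<partial>\<mu>)"
    using S(1) f_shift by (simp add: subset_iff)
  finally have "det_sum ?S A B / card ?S = (\<integral>Q. f Q \<partial>\<mu>)"
    using S by (simp add: card_gt_0_iff)
  then show ?thesis
    using S by (simp add: integral_pmf_of_set det_sum_def f_def)
qed

end
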